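(* For 2 players and 2 cakes, each cake cut into 2 pieces, there exist preferences for the two players, satisfying the assumptions described in the context, such that for no division $x$ are there disjoint piece selections $s_A\in\mathrm{Pref}_A(x)$ and $s_B\in\mathrm{Pref}_B(x)$. That is, a division with disjoint envy-free piece selections need not exist.
   Context: Model of multi-cake division. There are $m$ cakes, each of length $1$, and cake $i$ is cut into $k$ pieces (here $m=k=2$). A division is an $m\times k$ matrix $x=(x_{ij})$ with $x_{ij}\ge 0$ and $\sum_{j} x_{ij}=1$ for every $i$; $x_{ij}$ is the length of the $j$-th piece of cake $i$. A piece selection is a choice of one piece from each cake, i.e. a map $s:\{1,\dots,m\}\to\{1,\dots,k\}$. Two piece selections $s,s'$ are disjoint if $s(i)\ne s'(i)$ for every cake $i$. Each player (here $A$ and $B$) has preferences given by assigning to every division $x$ a nonempty set $\mathrm{Pref}(x)$ of preferred piece selections (those the player considers not worse than any other at $x$); preferences of a player depend only on that player. Assumptions: (hungry) a player prefers a nonempty piece in a cake to an empty one in that cake with the other cakes' pieces fixed, so no $s\in\mathrm{Pref}(x)$ contains an empty piece ($x_{i,s(i)}>0$ for all $i$); (closed) for each piece selection $s$ the set of divisions $x$ with $s\in\mathrm{Pref}(x)$ is closed. Envy-free piece selections at $x$ for the players are selections $s_A\in\mathrm{Pref}_A(x)$, $s_B\in\mathrm{Pref}_B(x)$. *)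

theory Defs
  imports "HOL-Analysis.Analysis"
begin

text \<open>
  A matrix \<open>x :: real ^ 'k ^ 'm\<close> has one row per cake and one column per piece:
  \<open>x $ i $ j\<close> is the length of the \<open>j\<close>-th piece of cake \<open>i\<close>.
\<close>

definition divisions :: "(real ^ 'k::finite ^ 'm::finite) set" where
  "divisions = {x. (\<forall>i j. 0 \<le> x $ i $ j) \<and> (\<forall>i. (\<Sum>j\<in>UNIV. x $ i $ j) = 1)}"

type_synonym ('m, 'k) selection = "'m \<Rightarrow> 'k"

definition disjoint_selections :: "('m, 'k) selection \<Rightarrow> ('m, 'k) selection \<Rightarrow> bool" where
  "disjoint_selections s s' \<longleftrightarrow> (\<forall>i. s i \<noteq> s' i)"

text \<open>
  A player's preferences map each division to the set of selections the player finds not worse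
  than any other there. Only the values on \<^const>\<open>divisions\<close> are meaningful, so every
  condition below is relativised to that set.
\<close>

type_synonym ('m, 'k) preference = "real ^ 'k ^ 'm \<Rightarrow> ('m, 'k) selection set"

definition nonempty_pref :: "('m::finite, 'k::finite) preference \<Rightarrow> bool" where
  "nonempty_pref Pref \<longleftrightarrow> (\<forall>x\<in>divisions. Pref x \<noteq> {})"

definition hungry :: "('m::finite, 'k::finite) preference \<Rightarrow> bool" where
  "hungry Pref \<longleftrightarrow> (\<forall>x\<in>divisions. \<forall>s\<in>Pref x. \<forall>i. x $ i $ s i > 0)"

text \<open>
  As \<^const>\<open>divisions\<close> is itself closed, closedness in the space of matrices
  agrees with closedness relative to \<^const>\<open>divisions\<close>.
\<close>

definition closed_pref :: "('m::finite, 'k::finite) preference \<Rightarrow> bool" where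
  "closed_pref Pref \<longleftrightarrow> (\<forall>s. closed {x \<in> divisions. s \<in> Pref x})"

definition admissible_pref :: "('m::finite, 'k::finite) preference \<Rightarrow> bool" where
  "admissible_pref Pref \<longleftrightarrow> nonempty_pref Pref \<and> hungry Pref \<and> closed_pref Pref"

end

theory Submission
  imports Defs
begin

text \<open>
  Identify a division with the point \<open>(a, b)\<close> of the unit square, \<open>a\<close> and \<open>b\<close> being the lengths
  of the first pieces; the four selections correspond to its corners. Player A's regions of two
  opposite corners meet along a segment of the line \<open>a + b = 1\<close>, and player B's regions of the
  other two corners meet along a segment of the line \<open>a = b\<close>. The two segments cross in the
  centre, where A accepts exactly one pair of opposite corners and B exactly the other pair, so
  that no selection of A is disjoint from one of B there. Each player's other two regions are
  small triangles at the corners, too far from the other player's region of the opposite corner.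
\<close>

definition diagonal_pref :: "bool \<Rightarrow> (2, 2) preference" where
  "diagonal_pref e x =
     {s. if (s 1 = s 2) = e
         then x $ 1 $ s 1 + x $ 2 $ s 2 \<ge> 1 \<and> \<bar>x $ 1 $ s 1 - x $ 2 $ s 2\<bar> \<le> 1/2
         else x $ 1 $ s 1 + x $ 2 $ s 2 \<ge> 3/2}"

lemma divisions_2:
  fixes x :: "real ^ 2 ^ 'm::finite"
  assumes "x \<in> divisions"
  shows "x $ i $ j \<le> 1" "j \<noteq> j' \<Longrightarrow> x $ i $ j' = 1 - x $ i $ j"
proof -
  have nn: "0 \<le> x $ i $ j" for j
    using assms by (auto simp: divisions_def)
  have sum: "x $ i $ 1 + x $ i $ 2 = 1"
    using assms by (auto simp: divisions_def sum_2)
  show "x $ i $ j \<le> 1" using exhaust_2[of j] nn[of 1] nn[of 2] sum by auto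
  show "x $ i $ j' = 1 - x $ i $ j" if "j \<noteq> j'"
    using exhaust_2[of j] exhaust_2[of j'] that sum by auto
qed

text \<open>The four regions cover the square: two corner triangles, and the band between them
  halved by its axis.\<close>

lemma nonempty_diagonal_pref: "nonempty_pref (diagonal_pref e)"
  unfolding nonempty_pref_def
proof
  fix x :: "real ^ 2 ^ 2" assume x: "x \<in> divisions"
  let ?s = "\<lambda>j j' (i::2). if i = 1 then j else j' :: 2"
  have mem: "?s j j' \<in> diagonal_pref e x \<longleftrightarrow>
      (if (j = j') = e then x $ 1 $ j + x $ 2 $ j' \<ge> 1 \<and> \<bar>x $ 1 $ j - x $ 2 $ j'\<bar> \<le> 1/2
       else x $ 1 $ j + x $ 2 $ j' \<ge> 3/2)" for j j'
    by (simp add: diagonal_pref_def)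
  define a b where "a = x $ 1 $ 1" and "b = x $ 2 $ 1"
  have ab: "x $ 1 $ 1 = a" "x $ 1 $ 2 = 1 - a" "x $ 2 $ 1 = b" "x $ 2 $ 2 = 1 - b"
    using divisions_2(2)[OF x, of 1 2] by (simp_all add: a_def b_def)
  have "\<exists>j j'. ?s j j' \<in> diagonal_pref e x"
  proof (cases e)
    case True
    consider "a - b \<ge> 1/2" | "b - a \<ge> 1/2" | "\<bar>a - b\<bar> \<le> 1/2" "a + b \<ge> 1"
      | "\<bar>a - b\<bar> \<le> 1/2" "a + b \<le> 1" by linarith
    then show ?thesis
    proof cases
      case 1
      then have "?s 1 2 \<in> diagonal_pref e x" unfolding mem ab using True by simp
      then show ?thesis by blast
    next
      case 2
      then have "?s 2 1 \<in> diagonal_pref e x" unfolding mem ab using True by simp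
      then show ?thesis by blast
    next
      case 3
      then have "?s 1 1 \<in> diagonal_pref e x" unfolding mem ab using True by simp
      then show ?thesis by blast
    next
      case 4
      then have "?s 2 2 \<in> diagonal_pref e x"
        unfolding mem ab using True by (simp add: abs_minus_commute)
      then show ?thesis by blast
    qed
  next
    case False
    \<comment> \<open>These are the cases for \<open>e\<close> after swapping the pieces of cake 2,
      that is, with \<open>1 - b\<close> for \<open>b\<close>.\<close>
    consider "a + b \<ge> 3/2" | "a + b \<le> 1/2" | "\<bar>a - (1 - b)\<bar> \<le> 1/2" "a \<ge> b"
      | "\<bar>1 - a - b\<bar> \<le> 1/2" "a \<le> b" by linarith
    then show ?thesis
    proof cases
      case 1
      then have "?s 1 1 \<in> diagonal_pref e x" unfolding mem ab using False by simp
      then show ?thesis by blast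
    next
      case 2
      then have "?s 2 2 \<in> diagonal_pref e x" unfolding mem ab using False by simp
      then show ?thesis by blast
    next
      case 3
      then have "?s 1 2 \<in> diagonal_pref e x" unfolding mem ab using False by simp
      then show ?thesis by blast
    next
      case 4
      then have "?s 2 1 \<in> diagonal_pref e x" unfolding mem ab using False by simp
      then show ?thesis by blast
    qed
  qed
  then show "diagonal_pref e x \<noteq> {}" by blast
qed

text \<open>A total of at least \<open>3/2\<close> leaves each piece at least \<open>1/2\<close>, as
  no piece exceeds \<open>1\<close>. A total of \<open>1\<close> alone would allow
  \<open>1 + 0\<close>; the bound on the difference raises each piece to at least
  \<open>1/4\<close>.\<close>

lemma hungry_diagonal_pref: "hungry (diagonal_pref e)"
  unfolding hungry_def
proof (intro ballI allI)
  fix x :: "real ^ 2 ^ 2" and s i assume x: "x \<in> divisions" and s: "s \<in> diagonal_pref e x"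
  have "\<bar>x $ 1 $ s 1 - x $ 2 $ s 2\<bar> \<le> 1/2 \<and> x $ 1 $ s 1 + x $ 2 $ s 2 \<ge> 1
      \<or> x $ 1 $ s 1 + x $ 2 $ s 2 \<ge> 3/2"
    using s by (auto simp: diagonal_pref_def split: if_splits)
  then have "x $ 1 $ s 1 > 0 \<and> x $ 2 $ s 2 > 0"
    using divisions_2(1)[OF x, of 1 "s 1"] divisions_2(1)[OF x, of 2 "s 2"] by linarith
  then show "x $ i $ s i > 0" using exhaust_2[of i] by auto
qed

lemma closed_divisions: "closed (divisions :: (real ^ 'k::finite ^ 'm::finite) set)"
  unfolding divisions_def
  by (intro closed_Collect_conj closed_Collect_all closed_Collect_le closed_Collect_eq
      continuous_intros)

lemma closed_diagonal_pref: "closed_pref (diagonal_pref e)"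
  unfolding closed_pref_def
proof
  fix s :: "(2, 2) selection"
  have "closed {x. s \<in> diagonal_pref e x}"
    \<comment> \<open>For fixed \<open>s\<close> this condition does not depend on \<open>x\<close>,
      so only weak inequalities between continuous functions remain.\<close>
    by (cases "(s 1 = s 2) = e")
      (auto simp: diagonal_pref_def
        intro!: closed_Collect_conj closed_Collect_le continuous_intros)
  with closed_divisions have "closed (divisions \<inter> {x. s \<in> diagonal_pref e x})"
    by (rule closed_Int)
  then show "closed {x \<in> divisions. s \<in> diagonal_pref e x}" by (simp add: Int_def)
qed

text \<open>Disjoint selections use up both cakes, so their lengths total \<open>2\<close>, whereas
  the two thresholds add up to \<open>3/2 + 1\<close>.\<close>

lemma not_disjoint_diagonal_pref:
  assumes x: "x \<in> divisions"
    and s: "s \<in> diagonal_pref e x" and s': "s' \<in> diagonal_pref (\<not> e) x"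
  shows "\<not> disjoint_selections s s'"
proof
  assume "disjoint_selections s s'"
  then have ne: "s 1 \<noteq> s' 1" "s 2 \<noteq> s' 2" by (auto simp: disjoint_selections_def)
  then have "(s' 1 = s' 2) = (s 1 = s 2)"
    using exhaust_2[of "s 1"] exhaust_2[of "s 2"] exhaust_2[of "s' 1"] exhaust_2[of "s' 2"]
    by auto
  \<comment> \<open>Both selections lie on the same diagonal of the square, and \<open>e\<close> is
    negated for one player, so exactly one of them faces the threshold \<open>3/2\<close>.\<close>
  then have "x $ 1 $ s 1 + x $ 2 $ s 2 \<ge> 3/2 \<and> x $ 1 $ s' 1 + x $ 2 $ s' 2 \<ge> 1
      \<or> x $ 1 $ s 1 + x $ 2 $ s 2 \<ge> 1 \<and> x $ 1 $ s' 1 + x $ 2 $ s' 2 \<ge> 3/2"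
    using s s' unfolding diagonal_pref_def mem_Collect_eq by argo
  then show False
    using divisions_2(2)[OF x ne(1), of 1] divisions_2(2)[OF x ne(2), of 2] by linarith
qed

theorem theorem3:
  "\<exists>PrefA PrefB :: (2, 2) preference.
     admissible_pref PrefA \<and> admissible_pref PrefB \<and>
     \<not> (\<exists>x\<in>divisions. \<exists>sA\<in>PrefA x. \<exists>sB\<in>PrefB x. disjoint_selections sA sB)"
proof (intro exI conjI)
  show "admissible_pref (diagonal_pref True)" "admissible_pref (diagonal_pref False)"
    by (simp_all add: admissible_pref_def nonempty_diagonal_pref hungry_diagonal_pref
        closed_diagonal_pref)
  show "\<not> (\<exists>x\<in>divisions. \<exists>sA\<in>diagonal_pref True x. \<exists>sB\<in>diagonal_pref False x.
      disjoint_selections sA sB)"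
    using not_disjoint_diagonal_pref[where e = True] by auto
qed

end
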